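(* For every real $x$, as power series in $t$, $$\Big(E\big[e_{\lambda}^{Y}(t)\big]\Big)^{x}=\sum_{n=0}^{\infty}\left(\sum_{k=0}^{n}{n\brace k}_{Y,\lambda}(x)_{k}\right)\frac{t^{n}}{n!}=\sum_{n=0}^{\infty}\left(\sum_{k=0}^{n}(-1)^{n-k}\langle x\rangle_{k,\lambda}S_{1,\lambda}^{Y}(n,k)\right)\frac{t^{n}}{n!}.$$
   Context: $\lambda$ is a fixed nonzero real number. For real $x$ and $n\ge1$: $(x)_{n}=x(x-1)\cdots(x-n+1)$, $(x)_{n,\lambda}=x(x-\lambda)\cdots(x-(n-1)\lambda)$, $\langle x\rangle_{n,\lambda}=x(x+\lambda)\cdots(x+(n-1)\lambda)$, and $(x)_0=(x)_{0,\lambda}=\langle x\rangle_{0,\lambda}=1$. The degenerate exponential is $e_{\lambda}^{x}(t)=(1+\lambda t)^{x/\lambda}=\sum_{n\ge0}(x)_{n,\lambda}\frac{t^n}{n!}$. The degenerate logarithm is, for $\mu\ne0$ and $u>0$, $\log_{\mu}(u)=\frac{1}{\mu}(u^{\mu}-1)$; in particular $\log_{-\lambda}(u)=-\frac1\lambda(u^{-\lambda}-1)$. $Y$ is a real random variable whose degenerate moment generating functions exist near the origin: for every nonzero real $\lambda$ there is $r=r(\lambda)>0$ with $E[e_{\lambda}^{Y}(t)]=\sum_{n\ge0}E[(Y)_{n,\lambda}]\frac{t^n}{n!}$ for $|t|<r$. All generating-function identities are power series expansions at $t=0$. Probabilistic degenerate Stirling numbers of the second kind: $\frac{1}{k!}\big(E[e_{\lambda}^{Y}(t)]-1\big)^k=\sum_{n\ge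 k}{n\brace k}_{Y,\lambda}\frac{t^n}{n!}$, $k\ge0$. Probabilistic degenerate Stirling numbers of the first kind: $\frac{1}{k!}\big(\log_{-\lambda}(E[e_{\lambda}^{Y}(t)])\big)^k=\sum_{n\ge k}(-1)^{n-k}S_{1,\lambda}^{Y}(n,k)\frac{t^n}{n!}$, $k\ge0$. *)

theory Defs
  imports "HOL-Probability.Probability"
begin

definition falling :: "real \<Rightarrow> nat \<Rightarrow> real" where
  "falling x n = (\<Prod>i<n. x - real i)"

definition deg_falling :: "real \<Rightarrow> real \<Rightarrow> nat \<Rightarrow> real" where
  "deg_falling lam x n = (\<Prod>i<n. x - real i * lam)"

definition deg_rising :: "real \<Rightarrow> real \<Rightarrow> nat \<Rightarrow> real" where
  "deg_rising lam x n = (\<Prod>i<n. x + real i * lam)"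

text \<open>The degenerate exponential and logarithm; they are only used where
  \<open>1 + lam * t > 0\<close> and \<open>u > 0\<close>, respectively.\<close>

definition deg_exp :: "real \<Rightarrow> real \<Rightarrow> real \<Rightarrow> real" where
  "deg_exp lam x t = (1 + lam * t) powr (x / lam)"

definition deg_log :: "real \<Rightarrow> real \<Rightarrow> real" where
  "deg_log mu u = 1 / mu * (u powr mu - 1)"

definition deg_mgf :: "'a measure \<Rightarrow> ('a \<Rightarrow> real) \<Rightarrow> real \<Rightarrow> real \<Rightarrow> real" where
  "deg_mgf M Y lam t = integral\<^sup>L M (\<lambda>\<omega>. deg_exp lam (Y \<omega>) t)"

text \<open>The standing assumption on \<open>Y\<close>. Integrability is stated explicitly because the
  Bochner integral of a non-integrable function is 0. The bound \<open>r \<le> 1 / \<bar>lam\<bar>\<close>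
  (no restriction, as \<open>r\<close> may always be decreased) guarantees \<open>1 + lam * t > 0\<close> for
  \<open>\<bar>t\<bar> < r\<close>.\<close>

definition has_deg_mgfs :: "'a measure \<Rightarrow> ('a \<Rightarrow> real) \<Rightarrow> bool" where
  "has_deg_mgfs M Y \<longleftrightarrow>
     (\<forall>lam. lam \<noteq> 0 \<longrightarrow>
        (\<forall>n. integrable M (\<lambda>\<omega>. deg_falling lam (Y \<omega>) n)) \<and>
        (\<exists>r>0. r \<le> 1 / \<bar>lam\<bar> \<and>
           (\<forall>t. \<bar>t\<bar> < r \<longrightarrow>
              integrable M (\<lambda>\<omega>. deg_exp lam (Y \<omega>) t) \<and>
              (\<lambda>n. integral\<^sup>L M (\<lambda>\<omega>. deg_falling lam (Y \<omega>) n) * t ^ n / fact n)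
                sums deg_mgf M Y lam t)))"

text \<open>The \<open>n\<close>-th coefficient of the exponential generating function that is the power series
  expansion of \<open>f\<close> at 0 (meaningful if \<open>f\<close> has such an expansion, which is then unique).\<close>

definition egf_coeff :: "(real \<Rightarrow> real) \<Rightarrow> nat \<Rightarrow> real" where
  "egf_coeff f n = fact n * fps_nth (THE F. f has_fps_expansion F) n"

lemma has_fps_expansion_unique_real:
  fixes f :: "real \<Rightarrow> real"
  assumes "f has_fps_expansion F" and "f has_fps_expansion G"
  shows "F = G"
proof (rule ccontr)
  assume "F \<noteq> G"
  define H where "H = F - G"
  define n where "n = subdegree H"
  define c where "c = fps_nth H n"
  have "H \<noteq> 0"
    using \<open>F \<noteq> G\<close> by (simp add: H_def)
  then have "c \<noteq> 0"
    unfolding c_def n_def by simp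
  have "(\<lambda>x. 0) has_fps_expansion H"
    using has_fps_expansion_diff[OF assms] by (simp add: H_def)
  then have "(\<lambda>x. if x = 0 then c else 0 / x ^ n) has_fps_expansion fps_shift n H"
    by (rule has_fps_expansion_shift) (simp_all add: n_def c_def)
  then have "(\<lambda>x. if x = 0 then c else 0) has_fps_expansion fps_shift n H"
    by (simp cong: if_cong)
  then have "isCont (\<lambda>x::real. if x = 0 then c else 0) 0"
    by (rule has_fps_expansion_imp_continuous)
  then have "(\<lambda>x::real. if x = 0 then c else 0) \<midarrow>0\<rightarrow> c"
    by (simp add: isCont_def)
  moreover have "(\<lambda>x::real. if x = 0 then c else 0) \<midarrow>0\<rightarrow> 0"
    by (rule Lim_transform_eventually[OF tendsto_const])
       (auto simp: eventually_at_filter)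
  ultimately show False
    using \<open>c \<noteq> 0\<close> LIM_unique by blast
qed

lemma egf_coeff_eq:
  assumes "f has_fps_expansion F"
  shows "egf_coeff f n = fact n * fps_nth F n"
proof -
  have "G = F" if "f has_fps_expansion G" for G
    using has_fps_expansion_unique_real[OF that assms] .
  then have "(THE F. f has_fps_expansion F) = F"
    using assms by blast
  then show ?thesis by (simp add: egf_coeff_def)
qed

definition prob_stirling2 :: "'a measure \<Rightarrow> ('a \<Rightarrow> real) \<Rightarrow> real \<Rightarrow> nat \<Rightarrow> nat \<Rightarrow> real" where
  "prob_stirling2 M Y lam n k =
     egf_coeff (\<lambda>t. 1 / fact k * (deg_mgf M Y lam t - 1) ^ k) n"

text \<open>The generating function defines \<open>(-1) ^ (n - k) * prob_stirling1 M Y lam n k\<close>; the sign is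
  moved to the other side. Truncation of \<open>n - k\<close> is harmless: for \<open>n < k\<close> the coefficient is 0,
  since \<open>deg_mgf M Y lam 0 = 1\<close>.\<close>

definition prob_stirling1 :: "'a measure \<Rightarrow> ('a \<Rightarrow> real) \<Rightarrow> real \<Rightarrow> nat \<Rightarrow> nat \<Rightarrow> real" where
  "prob_stirling1 M Y lam n k =
     (-1) ^ (n - k) * egf_coeff (\<lambda>t. 1 / fact k * (deg_log (- lam) (deg_mgf M Y lam t)) ^ k) n"

end

theory Submission
  imports Defs "HOL-Complex_Analysis.Laurent_Convergence"
begin

text \<open>
  Put \<open>F(t) = E[e\<^sub>\<lambda>\<^sup>Y(t)]\<close>, so that \<open>F(0) = 1\<close>. The first expansion is the binomial
  series of \<open>(1 + (F - 1))\<^sup>x\<close>. With \<open>L = log\<^bsub>-\<lambda>\<^esub> F\<close> we have \<open>F\<^bsup>-\<lambda>\<^esup> = 1 - \<lambda>L\<close>, so the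
  second expansion is the binomial series of \<open>F\<^sup>x = (1 - \<lambda>L)\<^bsup>-x/\<lambda>\<^esup>\<close>.
\<close>

text \<open>Real expansions are moved to complex ones so that analytic functions can be composed;
  coefficients, and hence the radius of convergence, carry over.\<close>

definition complex_fps :: "real fps \<Rightarrow> complex fps" where
  "complex_fps F = Abs_fps (\<lambda>n. complex_of_real (fps_nth F n))"

lemma complex_fps_nth [simp]: "fps_nth (complex_fps F) n = complex_of_real (fps_nth F n)"
  by (simp add: complex_fps_def)

lemma complex_fps_power: "complex_fps (F ^ k) = complex_fps F ^ k"
proof (induction k)
  case 0
  show ?case by (rule fps_ext) simp
next
  case (Suc k)
  have "complex_fps (F * F ^ k) = complex_fps F * complex_fps (F ^ k)"
    by (rule fps_ext) (simp add: fps_mult_nth)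
  with Suc show ?case by simp
qed

lemma complex_fps_compose: "complex_fps (F oo G) = complex_fps F oo complex_fps G"
  by (rule fps_ext) (simp add: fps_compose_nth flip: complex_fps_power)

lemma fps_conv_radius_complex_fps [simp]: "fps_conv_radius (complex_fps F) = fps_conv_radius F"
  by (simp add: fps_conv_radius_def conv_radius_def)

text \<open>The sum of the series itself is the complex extension of \<open>f\<close>: it converges
  on a complex disc of the same radius and returns \<open>f\<close> on the real points near
  0.\<close>

lemma has_fps_expansion_complex_fps:
  assumes "f has_fps_expansion F"
  shows "eval_fps (complex_fps F) has_fps_expansion complex_fps F"
    and "\<forall>\<^sub>F t in nhds 0. eval_fps (complex_fps F) (of_real t) = of_real (f t)"
proof -
  have r: "fps_conv_radius F > 0" and f: "\<forall>\<^sub>F t in nhds 0. eval_fps F t = f t"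
    using assms by (auto simp: has_fps_expansion_def)
  show "eval_fps (complex_fps F) has_fps_expansion complex_fps F"
    using r by (simp add: has_fps_expansion_def)
  have "\<forall>\<^sub>F t in nhds 0. t \<in> eball 0 (fps_conv_radius F)"
    using r by (intro eventually_nhds_in_open) (auto simp: zero_ereal_def)
  with f show "\<forall>\<^sub>F t in nhds 0. eval_fps (complex_fps F) (of_real t) = of_real (f t)"
  proof eventually_elim
    case (elim t)
    then have "(\<lambda>n. fps_nth F n * t ^ n) sums f t"
      using sums_eval_fps[of t F] by simp
    then have "(\<lambda>n. fps_nth (complex_fps F) n * of_real t ^ n) sums of_real (f t)"
      by (simp flip: of_real_mult of_real_power add: sums_of_real_iff)
    then show ?case
      by (simp add: eval_fps_def sums_iff)
  qed
qed

text \<open>Reduces to the complex composition rule, applied to the complex extensions of \<open>f\<close> and \<open>g\<close>.\<close>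

lemma has_fps_expansion_compose_real:
  fixes f g :: "real \<Rightarrow> real"
  assumes f: "f has_fps_expansion F" and g: "g has_fps_expansion G" and "fps_nth G 0 = 0"
  shows "(\<lambda>t. f (g t)) has_fps_expansion (F oo G)"
proof (rule has_fps_expansionI)
  let ?f = "eval_fps (complex_fps F)" and ?g = "eval_fps (complex_fps G)"
  have "(?f \<circ> ?g) has_fps_expansion complex_fps (F oo G)"
    unfolding complex_fps_compose using assms(3)
    by (intro has_fps_expansion_compose has_fps_expansion_complex_fps(1)[OF f]
        has_fps_expansion_complex_fps(1)[OF g]) simp_all
  then have "fps_conv_radius (F oo G) > 0"
    and "\<forall>\<^sub>F z in nhds 0. eval_fps (complex_fps (F oo G)) z = (?f \<circ> ?g) z"
    by (auto simp: has_fps_expansion_def)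
  moreover have "filterlim complex_of_real (nhds 0) (nhds 0)"
    by (auto simp: tendsto_nhds_iff intro!: tendsto_eq_intros)
  ultimately have fg: "\<forall>\<^sub>F t in nhds 0. eval_fps (complex_fps (F oo G)) (of_real t) = ?f (?g (of_real t))"
    by (auto simp: filterlim_iff)
  have "\<forall>\<^sub>F t in nhds 0. t \<in> eball 0 (fps_conv_radius (F oo G))"
    using \<open>fps_conv_radius (F oo G) > 0\<close> by (intro eventually_nhds_in_open) (auto simp: zero_ereal_def)
  \<comment> \<open>Since \<open>g\<close> is continuous with \<open>g 0 = 0\<close>, its values
    enter the neighbourhood of 0 on which the complex extension of \<open>f\<close> agrees with
    \<open>f\<close>.\<close>
  moreover have "filterlim g (nhds 0) (nhds 0)"
    using has_fps_expansion_imp_continuous[OF g, of UNIV] has_fps_expansion_imp_0_eq_fps_nth_0[OF g] assms(3)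
    by (simp add: isCont_def tendsto_nhds_iff)
  then have "\<forall>\<^sub>F t in nhds 0. ?f (of_real (g t)) = of_real (f (g t))"
    using has_fps_expansion_complex_fps(2)[OF f] by (auto simp: filterlim_iff)
  ultimately show "\<forall>\<^sub>F t in nhds 0. (\<lambda>n. fps_nth (F oo G) n * t ^ n) sums f (g t)"
    using fg has_fps_expansion_complex_fps(2)[OF g]
  proof eventually_elim
    case (elim t)
    then have "(\<lambda>n. fps_nth (complex_fps (F oo G)) n * of_real t ^ n) sums of_real (f (g t))"
      using sums_eval_fps[of "of_real t" "complex_fps (F oo G)"] by simp
    then show ?case
      by (simp flip: of_real_mult of_real_power add: sums_of_real_iff)
  qed
qed

lemma falling_eq_gbinomial: "falling x k = fact k * (x gchoose k)"
  by (simp add: falling_def gbinomial_prod_rev atLeast0LessThan)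

text \<open>Each factor \<open>x + i * lam\<close> equals \<open>(- x / lam - i) * (- lam)\<close>.
  The powers of \<open>- lam\<close> will be absorbed into the inner series of a binomial expansion
  with exponent \<open>- x / lam\<close>.\<close>

lemma deg_rising_eq_gbinomial:
  assumes "lam \<noteq> 0"
  shows "deg_rising lam x k = fact k * ((- x / lam) gchoose k) * (- lam) ^ k"
proof -
  have "deg_rising lam x k = (\<Prod>i<k. (- x / lam - real i) * (- lam))"
    unfolding deg_rising_def using assms by (intro prod.cong) (auto simp: field_simps)
  also have "\<dots> = (\<Prod>i<k. - x / lam - real i) * (- lam) ^ k"
    by (simp only: prod.distrib) simp
  finally show ?thesis
    using falling_eq_gbinomial[of "- x / lam" k] by (simp add: falling_def)
qed

lemma has_fps_expansion_one_plus_powr: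
  fixes u :: "real \<Rightarrow> real"
  assumes "u has_fps_expansion U" and "fps_nth U 0 = 0"
  shows "(\<lambda>t. (1 + u t) powr x) has_fps_expansion (fps_binomial x oo U)"
proof -
  have "\<forall>\<^sub>F z::real in nhds 0. z \<in> {-1<..<1}"
    by (intro eventually_nhds_in_open) auto
  then have "(\<lambda>z::real. (1 + z) powr x) has_fps_expansion fps_binomial x"
    by (intro has_fps_expansionI, elim eventually_mono)
       (auto intro: gen_binomial_real)
  then show ?thesis
    by (rule has_fps_expansion_compose_real[OF _ assms])
qed

text \<open>Both kinds of Stirling numbers are read off from powers of a function with a known
  expansion; uniqueness of that expansion resolves the \<open>THE\<close> in
  \<open>egf_coeff\<close>.\<close>

lemma egf_coeff_power:
  assumes "u has_fps_expansion U"
  shows "egf_coeff (\<lambda>t. u t ^ k / fact k) n = fact n / fact k * fps_nth (U ^ k) n"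
  using egf_coeff_eq[OF has_fps_expansion_cmult_left[OF has_fps_expansion_power[OF assms], of "1 / fact k"]]
  by simp

lemma has_fps_expansion_deg_mgf:
  assumes "prob_space M" and "has_deg_mgfs M Y" and "lam \<noteq> 0"
  obtains F where "deg_mgf M Y lam has_fps_expansion F" and "fps_nth F 0 = 1"
proof
  interpret prob_space M by fact
  let ?F = "Abs_fps (\<lambda>n. integral\<^sup>L M (\<lambda>\<omega>. deg_falling lam (Y \<omega>) n) / fact n)"
  obtain r where "r > 0" and r: "\<And>t. \<bar>t\<bar> < r \<Longrightarrow>
      (\<lambda>n. integral\<^sup>L M (\<lambda>\<omega>. deg_falling lam (Y \<omega>) n) * t ^ n / fact n) sums deg_mgf M Y lam t"
    using assms(2,3) unfolding has_deg_mgfs_def by blast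
  have "\<forall>\<^sub>F t in nhds 0. t \<in> {-r<..<r}"
    using \<open>r > 0\<close> by (intro eventually_nhds_in_open) auto
  then show "deg_mgf M Y lam has_fps_expansion ?F"
  proof (intro has_fps_expansionI, elim eventually_mono)
    fix t assume "t \<in> {-r<..<r}"
    then show "(\<lambda>n. fps_nth ?F n * t ^ n) sums deg_mgf M Y lam t"
      using r[of t] by (simp add: abs_less_iff)
  qed
  \<comment> \<open>The empty product is 1, so this coefficient is the total mass of
    \<open>M\<close>.\<close>
  show "fps_nth ?F 0 = 1"
    by (simp add: deg_falling_def prob_space)
qed

theorem theorem2p2:
  fixes M :: "'a measure" and Y :: "'a \<Rightarrow> real" and lam x :: real
  assumes "prob_space M"
    and "Y \<in> borel_measurable M"
    and "has_deg_mgfs M Y"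
    and "lam \<noteq> 0"
  shows "((\<lambda>t. deg_mgf M Y lam t powr x) has_fps_expansion
            Abs_fps (\<lambda>n. (\<Sum>k=0..n. prob_stirling2 M Y lam n k * falling x k) / fact n)) \<and>
         Abs_fps (\<lambda>n. (\<Sum>k=0..n. prob_stirling2 M Y lam n k * falling x k) / fact n) =
         Abs_fps (\<lambda>n. (\<Sum>k=0..n. (-1) ^ (n - k) * deg_rising lam x k *
                                  prob_stirling1 M Y lam n k) / fact n)"
    (is "(?f has_fps_expansion ?A) \<and> ?A = ?B")
proof -
  let ?m = "deg_mgf M Y lam" and ?l = "\<lambda>t. deg_log (- lam) (deg_mgf M Y lam t)"
  obtain F where F: "?m has_fps_expansion F" and F0: "fps_nth F 0 = 1"
    using has_fps_expansion_deg_mgf[OF assms(1,3,4)] .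
  have U: "(\<lambda>t. ?m t - 1) has_fps_expansion F - 1"
    by (intro has_fps_expansion_diff F has_fps_expansion_1)
  have powr: "(\<lambda>t. ?m t powr y) has_fps_expansion (fps_binomial y oo (F - 1))" for y
    using has_fps_expansion_one_plus_powr[OF U, of y] F0 by simp

  define L where "L = fps_const (- 1 / lam) * ((fps_binomial (- lam) oo (F - 1)) - 1)"
  have L: "?l has_fps_expansion L"
    using has_fps_expansion_cmult_left[OF
        has_fps_expansion_diff[OF powr[of "- lam"] has_fps_expansion_1], of "- 1 / lam"]
    by (simp add: deg_log_def L_def)
  have L0: "fps_nth L 0 = 0"
    by (simp add: L_def)

  \<comment> \<open>In each coefficient of the composition the \<open>fact k\<close> of
    \<open>falling x k\<close> cancels the one in the Stirling number, and \<open>fact n\<close>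
    cancels as well.\<close>
  have "?A = fps_binomial x oo (F - 1)"
    by (rule fps_ext)
       (simp add: fps_compose_nth prob_stirling2_def egf_coeff_power[OF U] falling_eq_gbinomial
          sum_divide_distrib mult.commute)
  then have A: "?f has_fps_expansion ?A"
    using powr by simp

  \<comment> \<open>The sign \<open>(-1) ^ (n - k)\<close> occurs in \<open>?B\<close> and again in
    \<open>prob_stirling1\<close>, so it squares to 1.\<close>
  have "?B = fps_binomial (- x / lam) oo (fps_const (- lam) * L)"
    by (rule fps_ext)
       (simp add: fps_compose_nth prob_stirling1_def egf_coeff_power[OF L]
          deg_rising_eq_gbinomial[OF assms(4)] sum_divide_distrib power_mult_distrib
          fps_const_power mult.left_commute mult.commute)
  moreover have "(\<lambda>t. (1 + (- lam) * ?l t) powr (- x / lam)) has_fps_expansion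
      (fps_binomial (- x / lam) oo (fps_const (- lam) * L))"
    using L0 by (intro has_fps_expansion_one_plus_powr has_fps_expansion_cmult_left L) simp
  moreover have "1 + (- lam) * ?l t = ?m t powr (- lam)" for t
    using assms(4) by (simp add: deg_log_def)
  \<comment> \<open>The exponents multiply: \<open>(- lam) * (- x / lam) = x\<close>. The two formal
    series then agree because they expand the same function.\<close>
  ultimately have "?f has_fps_expansion ?B"
    using assms(4) by (simp add: powr_powr)
  with A show ?thesis
    using has_fps_expansion_unique_real by blast
qed

end
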